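(* Let $A\subset\mathbf{Z}_{\geq0}$ be finite with $0\in A$, $N=\#A\geq 2$, and $\Omega=A+[0,1)$. Suppose $\Omega\subset[0,M]$ for some $M<5N/2$, and that $\Lambda$ is a spectrum for $\Omega$ with $0\in\Lambda$. Then $\Lambda\subset\mathbf{Q}$.
   Context: A set $\Lambda\subset\mathbf{R}$ is a spectrum for $\Omega$ if $\{e^{2\pi i\lambda x}\}_{\lambda\in\Lambda}$ is an orthogonal basis of $L^2(\Omega)$. *)

theory Defs
  imports "HOL-Analysis.Analysis"
begin

definition expo :: "real \<Rightarrow> real \<Rightarrow> complex" where
  "expo l x = exp (2 * pi * \<i> * complex_of_real (l * x))"

definition L2_inner :: "real set \<Rightarrow> (real \<Rightarrow> complex) \<Rightarrow> (real \<Rightarrow> complex) \<Rightarrow> complex" where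
  "L2_inner \<Omega> f g = (LINT x:\<Omega>|lborel. f x * cnj (g x))"

definition in_L2 :: "real set \<Rightarrow> (real \<Rightarrow> complex) \<Rightarrow> bool" where
  "in_L2 \<Omega> f \<longleftrightarrow> f \<in> borel_measurable lborel \<and>
     set_integrable lborel \<Omega> (\<lambda>x. (cmod (f x))\<^sup>2)"

text \<open>Lambda is a spectrum for Omega: the exponentials indexed by Lambda form an
  orthogonal basis of L^2(Omega), i.e. they are pairwise orthogonal, nonzero in L^2(Omega),
  and complete (only the zero element of L^2 is orthogonal to all of them).\<close>
definition is_spectrum :: "real set \<Rightarrow> real set \<Rightarrow> bool" where
  "is_spectrum \<Lambda> \<Omega> \<longleftrightarrow>
     (\<forall>l\<in>\<Lambda>. in_L2 \<Omega> (expo l) \<and> L2_inner \<Omega> (expo l) (expo l) \<noteq> 0) \<and>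
     (\<forall>l\<in>\<Lambda>. \<forall>m\<in>\<Lambda>. l \<noteq> m \<longrightarrow> L2_inner \<Omega> (expo l) (expo m) = 0) \<and>
     (\<forall>f. in_L2 \<Omega> f \<longrightarrow> (\<forall>l\<in>\<Lambda>. L2_inner \<Omega> f (expo l) = 0) \<longrightarrow>
          (AE x in lborel. x \<in> \<Omega> \<longrightarrow> f x = 0))"

end

(* Write A(x) for the mask polynomial, the sum of x^a over a in A, and Z for the set of nodes
   e(l) = exp(2 pi i l), l in the spectrum. Orthogonality says that all quotients of distinct nodes are roots of A,
   and completeness gives |Z| = N. If some node z is not a root of unity, then by Kronecker's theorem
   a conjugate of z lies off the unit circle, and a field embedding s with |s(z)| <> 1 exists on a
   subfield containing Z. Let F be the set of nodes where |s| attains its minimum, or its maximum,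
   whichever is smaller, and let b be in F. The roots w/b (w in F, w <> b), the roots w/b and b/w
   (w in Z - F), all on the unit circle, and the images of the latter under s, off the circle, are
   distinct. Hence deg A >= 4N - 3|F| - 1 >= 5N/2 - 1, against deg A + 1 <= M < 5N/2. *)
theory Submission
  imports Defs "HOL-Computational_Algebra.Fundamental_Theorem_Algebra"
begin

section \<open>Extending embeddings of subfields\<close>

definition polys_over :: "'a::zero set \<Rightarrow> 'a poly set" where
  "polys_over R = {p. \<forall>i. coeff p i \<in> R}"

text \<open>The domains grow as elements are adjoined, so they are sets in one fixed type, and
  \<open>\<sigma>\<close> is a total function of which nothing is assumed outside
  \<open>R\<close>.\<close>

locale ring_hom_on =
  fixes R :: "'a::comm_ring_1 set" and \<sigma> :: "'a \<Rightarrow> 'b::comm_ring_1"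
  assumes zero_mem: "0 \<in> R" and one_mem: "1 \<in> R"
    and add_mem: "\<lbrakk>x \<in> R; y \<in> R\<rbrakk> \<Longrightarrow> x + y \<in> R"
    and mult_mem: "\<lbrakk>x \<in> R; y \<in> R\<rbrakk> \<Longrightarrow> x * y \<in> R"
    and uminus_mem: "x \<in> R \<Longrightarrow> - x \<in> R"
    and hom_one: "\<sigma> 1 = 1"
    and hom_add: "\<lbrakk>x \<in> R; y \<in> R\<rbrakk> \<Longrightarrow> \<sigma> (x + y) = \<sigma> x + \<sigma> y"
    and hom_mult: "\<lbrakk>x \<in> R; y \<in> R\<rbrakk> \<Longrightarrow> \<sigma> (x * y) = \<sigma> x * \<sigma> y"
begin

lemma hom_zero: "\<sigma> 0 = 0"
  using hom_add[OF zero_mem zero_mem] by simp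

lemma hom_uminus: "x \<in> R \<Longrightarrow> \<sigma> (- x) = - \<sigma> x"
  using hom_add[of x "- x"] hom_zero uminus_mem by (simp add: eq_neg_iff_add_eq_0 add.commute)

lemma diff_mem: "\<lbrakk>x \<in> R; y \<in> R\<rbrakk> \<Longrightarrow> x - y \<in> R"
  using add_mem[of x "- y"] uminus_mem by simp

lemma sum_mem: "(\<And>i. i \<in> I \<Longrightarrow> f i \<in> R) \<Longrightarrow> sum f I \<in> R"
  by (induction I rule: infinite_finite_induct) (auto intro: zero_mem add_mem)

lemma hom_sum: "(\<And>i. i \<in> I \<Longrightarrow> f i \<in> R) \<Longrightarrow> \<sigma> (sum f I) = (\<Sum>i\<in>I. \<sigma> (f i))"
  by (induction I rule: infinite_finite_induct) (auto simp: hom_zero hom_add sum_mem)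

lemma power_mem: "x \<in> R \<Longrightarrow> x ^ n \<in> R"
  by (induction n) (auto intro: one_mem mult_mem)

lemma hom_power: "x \<in> R \<Longrightarrow> \<sigma> (x ^ n) = \<sigma> x ^ n"
  by (induction n) (auto simp: hom_one hom_mult power_mem)

lemma polys_over_0: "0 \<in> polys_over R"
  and polys_over_1: "1 \<in> polys_over R"
  by (auto simp: polys_over_def zero_mem one_mem)

lemma polys_over_const: "c \<in> R \<Longrightarrow> [:c:] \<in> polys_over R"
  by (auto simp: polys_over_def zero_mem coeff_pCons split: nat.split)

lemma polys_over_X: "[:0, 1:] \<in> polys_over R"
  by (auto simp: polys_over_def zero_mem one_mem coeff_pCons split: nat.split)

lemma polys_over_monom: "c \<in> R \<Longrightarrow> monom c n \<in> polys_over R"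
  by (auto simp: polys_over_def zero_mem)

lemma polys_over_add: "\<lbrakk>p \<in> polys_over R; q \<in> polys_over R\<rbrakk> \<Longrightarrow> p + q \<in> polys_over R"
  by (auto simp: polys_over_def add_mem)

lemma polys_over_diff: "\<lbrakk>p \<in> polys_over R; q \<in> polys_over R\<rbrakk> \<Longrightarrow> p - q \<in> polys_over R"
  by (auto simp: polys_over_def diff_mem)

lemma polys_over_uminus: "p \<in> polys_over R \<Longrightarrow> - p \<in> polys_over R"
  by (auto simp: polys_over_def uminus_mem)

lemma polys_over_mult: "\<lbrakk>p \<in> polys_over R; q \<in> polys_over R\<rbrakk> \<Longrightarrow> p * q \<in> polys_over R"
  by (auto simp: polys_over_def coeff_mult intro!: sum_mem mult_mem)

lemma coeff_map_poly_hom: "coeff (map_poly \<sigma> p) i = \<sigma> (coeff p i)"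
  by (simp add: coeff_map_poly hom_zero)

lemma map_poly_hom_add:
  "\<lbrakk>p \<in> polys_over R; q \<in> polys_over R\<rbrakk> \<Longrightarrow> map_poly \<sigma> (p + q) = map_poly \<sigma> p + map_poly \<sigma> q"
  by (intro poly_eqI) (auto simp: coeff_map_poly_hom polys_over_def hom_add)

lemma map_poly_hom_mult:
  "\<lbrakk>p \<in> polys_over R; q \<in> polys_over R\<rbrakk> \<Longrightarrow> map_poly \<sigma> (p * q) = map_poly \<sigma> p * map_poly \<sigma> q"
  by (intro poly_eqI)
     (auto simp: coeff_map_poly_hom polys_over_def coeff_mult hom_sum hom_mult mult_mem)

text \<open>This carries roots to roots: if \<open>p\<close> vanishes at \<open>x\<close>, then its
  image vanishes at \<open>\<sigma> x\<close>.\<close>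

lemma poly_map_poly_hom:
  assumes "p \<in> polys_over R" "x \<in> R"
  shows "poly (map_poly \<sigma> p) (\<sigma> x) = \<sigma> (poly p x)"
proof -
  \<comment> \<open>\<open>\<sigma>\<close> may kill the leading coefficient, so the degree may
    drop; the sum is padded with zero terms up to \<open>degree p\<close>.\<close>
  have deg: "degree (map_poly \<sigma> p) \<le> degree p"
    by (intro degree_le) (auto simp: coeff_map_poly_hom hom_zero coeff_eq_0)
  have "poly (map_poly \<sigma> p) (\<sigma> x) = (\<Sum>i\<le>degree p. \<sigma> (coeff p i) * \<sigma> x ^ i)"
    unfolding poly_altdef coeff_map_poly_hom[symmetric] using deg
    by (intro sum.mono_neutral_left) (auto simp: coeff_eq_0)
  also have "\<dots> = \<sigma> (poly p x)"
    using assms unfolding poly_altdef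
    by (subst hom_sum) (auto simp: polys_over_def hom_mult hom_power mult_mem power_mem)
  finally show ?thesis .
qed

end

text \<open>The integers form no field; this instance is why the ring version is kept apart from the
  one for subfields.\<close>

lemma ring_hom_on_of_int: "ring_hom_on UNIV (of_int :: int \<Rightarrow> 'a::comm_ring_1)"
  by unfold_locales auto

lemma polys_over_UNIV [simp]: "polys_over UNIV = UNIV"
  by (simp add: polys_over_def)

section \<open>Division with remainder over a subfield, and adjoining algebraic elements\<close>

locale subfield_hom = ring_hom_on K \<sigma>
  for K :: "'a::field set" and \<sigma> :: "'a \<Rightarrow> 'b::field" +
  assumes inverse_mem: "x \<in> K \<Longrightarrow> inverse x \<in> K"
begin

lemma divide_mem: "\<lbrakk>x \<in> K; y \<in> K\<rbrakk> \<Longrightarrow> x / y \<in> K"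
  by (simp add: divide_inverse inverse_mem mult_mem)

lemma hom_eq_0_iff: "x \<in> K \<Longrightarrow> \<sigma> x = 0 \<longleftrightarrow> x = 0"
proof (cases "x = 0")
  case False
  assume "x \<in> K"
  then have "\<sigma> x * \<sigma> (inverse x) = 1"
    using hom_mult[of x "inverse x"] False by (simp add: hom_one inverse_mem)
  then show ?thesis using False by auto
qed (simp add: hom_zero)

lemma hom_inj: "inj_on \<sigma> K"
proof
  fix x y assume "x \<in> K" "y \<in> K" "\<sigma> x = \<sigma> y"
  then have "\<sigma> (x - y) = 0"
    using hom_add[of x "- y"] by (simp add: hom_uminus uminus_mem)
  with \<open>x \<in> K\<close> \<open>y \<in> K\<close> show "x = y"
    by (simp add: hom_eq_0_iff diff_mem)
qed

lemma hom_divide: "\<lbrakk>x \<in> K; y \<in> K\<rbrakk> \<Longrightarrow> \<sigma> (x / y) = \<sigma> x / \<sigma> y"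
proof (cases "y = 0")
  case False
  assume "x \<in> K" "y \<in> K"
  then show ?thesis
    using hom_mult[of "x / y" y] False by (simp add: divide_mem hom_eq_0_iff eq_divide_eq)
qed (simp add: hom_zero)

text \<open>Long division: each step subtracts a monomial multiple of \<open>p\<close> whose
  coefficient is a quotient of leading coefficients, hence in \<open>K\<close>.\<close>

lemma polys_over_division:
  assumes p: "p \<in> polys_over K" "p \<noteq> 0" and f: "f \<in> polys_over K"
  shows "\<exists>q\<in>polys_over K. \<exists>r\<in>polys_over K. f = p * q + r \<and> (r = 0 \<or> degree r < degree p)"
  using f
proof (induction "degree f" arbitrary: f rule: less_induct)
  case less
  show ?case
  proof (cases "degree f < degree p")
    case True
    then show ?thesis
      using less.prems polys_over_0 by (intro bexI[of _ 0] bexI[of _ f]) auto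
  next
    case False
    show ?thesis
    proof (cases "degree f = 0")
      \<comment> \<open>The zero polynomial also has degree 0, so no strict descent is possible from
        here; both polynomials are constants and the division is exact.\<close>
      case True
      with False have "degree p = 0" by simp
      with True obtain a b where ab: "f = [:a:]" "p = [:b:]"
        by (meson degree_eq_zeroE)
      have "coeff f 0 / coeff p 0 \<in> K"
        using less.prems p by (intro divide_mem) (auto simp: polys_over_def)
      then show ?thesis
        using ab p by (intro bexI[of _ "[:a / b:]"] bexI[of _ 0] polys_over_const polys_over_0) auto
    next
      case nz: False
      define m where "m = monom (lead_coeff f / lead_coeff p) (degree f - degree p)"
      have m: "m \<in> polys_over K"
        unfolding m_def using less.prems p
        by (intro polys_over_monom divide_mem) (auto simp: polys_over_def)
      have lc: "lead_coeff f \<noteq> 0" using nz by auto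
      have "degree (p * m) = degree f"
        using False p lc by (subst degree_mult_eq) (auto simp: m_def degree_monom_eq)
      moreover have "coeff (p * m) (degree f) = lead_coeff f"
        using False p lc \<open>degree (p * m) = degree f\<close> lead_coeff_mult[of p m]
        by (simp add: m_def degree_monom_eq)
      ultimately have "degree (f - p * m) < degree f"
        using nz degree_diff_le[of f "degree f" "p * m"]
        by (metis coeff_diff diff_self eq_zero_or_degree_less order.order_iff_strict degree_0 nat_neq_iff
            neq0_conv)
      moreover have "f - p * m \<in> polys_over K"
        by (intro polys_over_diff polys_over_mult less.prems p m)
      ultimately obtain q r where qr: "q \<in> polys_over K" "r \<in> polys_over K"
        "f - p * m = p * q + r" "r = 0 \<or> degree r < degree p"
        using less.hyps by blast
      then show ?thesis
        by (intro bexI[of _ "q + m"] bexI[of _ r] polys_over_add m) (auto simp: algebra_simps)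
    qed
  qed
qed

text \<open>The extension is evaluation of \<open>\<sigma> f\<close> at \<open>\<beta>\<close> on the subfield \<open>K[\<alpha>]\<close>; minimality of
  \<open>p\<close> makes it well defined and makes \<open>K[\<alpha>]\<close> closed under inverses.\<close>
lemma extend_simple:
  assumes p: "p \<in> polys_over K" "p \<noteq> 0" "poly p \<alpha> = 0"
    and minimal: "\<And>h. \<lbrakk>h \<in> polys_over K; h \<noteq> 0; poly h \<alpha> = 0\<rbrakk> \<Longrightarrow> degree p \<le> degree h"
    and \<beta>: "poly (map_poly \<sigma> p) \<beta> = 0"
  shows "\<exists>K' \<tau>. subfield_hom K' \<tau> \<and> K \<subseteq> K' \<and> \<alpha> \<in> K' \<and> \<tau> \<alpha> = \<beta> \<and> (\<forall>x\<in>K. \<tau> x = \<sigma> x)"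
proof -
  have zero: "r = 0" if "r \<in> polys_over K" "poly r \<alpha> = 0" "r = 0 \<or> degree r < degree p" for r
  proof (rule ccontr)
    assume "r \<noteq> 0"
    then show False using minimal[OF that(1) _ that(2)] that(3) by simp
  qed
  \<comment> \<open>Well-definedness: a polynomial over \<open>K\<close> vanishing at
    \<open>\<alpha>\<close> is a multiple of \<open>p\<close>, so its image vanishes at
    \<open>\<beta>\<close>.\<close>
  have root: "poly (map_poly \<sigma> h) \<beta> = 0" if h: "h \<in> polys_over K" "poly h \<alpha> = 0" for h
  proof -
    obtain q r where qr: "q \<in> polys_over K" "r \<in> polys_over K"
        "h = p * q + r" "r = 0 \<or> degree r < degree p"
      using polys_over_division[OF p(1,2) h(1)] by blast
    then have "poly r \<alpha> = 0" using h(2) p(3) by simp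
    with qr have "r = 0" by (intro zero)
    then show ?thesis
      using qr p \<beta> by (simp add: map_poly_hom_mult)
  qed
  define K' where "K' = (\<lambda>f. poly f \<alpha>) ` polys_over K"
  have K'I: "poly f \<alpha> \<in> K'" if "f \<in> polys_over K" for f
    using that by (simp add: K'_def)
  define \<tau> where "\<tau> x = poly (map_poly \<sigma> (SOME f. f \<in> polys_over K \<and> poly f \<alpha> = x)) \<beta>" for x
  have \<tau>: "\<tau> (poly f \<alpha>) = poly (map_poly \<sigma> f) \<beta>" if f: "f \<in> polys_over K" for f
  proof -
    define g where "g = (SOME g. g \<in> polys_over K \<and> poly g \<alpha> = poly f \<alpha>)"
    have g: "g \<in> polys_over K" "poly g \<alpha> = poly f \<alpha>"
      using someI[of "\<lambda>g. g \<in> polys_over K \<and> poly g \<alpha> = poly f \<alpha>" f] f by (auto simp: g_def)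
    have "f - g \<in> polys_over K" "poly (f - g) \<alpha> = 0"
      using f g by (auto intro: polys_over_diff)
    then have "poly (map_poly \<sigma> (f - g)) \<beta> = 0" by (rule root)
    moreover have "map_poly \<sigma> f = map_poly \<sigma> (f - g) + map_poly \<sigma> g"
      using map_poly_hom_add[of "f - g" g] f g by (simp add: polys_over_diff)
    ultimately show ?thesis by (simp add: \<tau>_def g_def)
  qed
  have inv: "inverse x \<in> K'" if x: "x \<in> K'" for x
  proof (cases "x = 0")
    case True
    then show ?thesis using x by simp
  next
    case False
    from x obtain f where f: "f \<in> polys_over K" "x = poly f \<alpha>" by (auto simp: K'_def)
    \<comment> \<open>\<open>P\<close> collects polynomials whose value at \<alpha> is a nonzero
      multiple of \<open>x\<close> in K[\<alpha>]. One of least degree will turn out to be a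
      constant c = x h(\<alpha>), which exhibits the inverse of \<open>x\<close>.\<close>
    define P where "P g \<longleftrightarrow> g \<in> polys_over K \<and> poly g \<alpha> \<noteq> 0 \<and> (\<exists>h\<in>polys_over K. poly g \<alpha> = x * poly h \<alpha>)"
      for g
    have "P f" using f False polys_over_1 unfolding P_def by (intro conjI bexI[of _ 1]) simp_all
    define g where "g = arg_min degree P"
    have g: "P g" and gmin: "\<And>g'. P g' \<Longrightarrow> degree g \<le> degree g'"
      using arg_min_nat_lemma[of P f degree] \<open>P f\<close> by (auto simp: g_def)
    from g obtain h where h: "h \<in> polys_over K" "poly g \<alpha> = x * poly h \<alpha>"
      and g': "g \<in> polys_over K" "poly g \<alpha> \<noteq> 0" by (auto simp: P_def)
    then have "g \<noteq> 0" by auto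
    obtain q r where qr: "q \<in> polys_over K" "r \<in> polys_over K"
        "p = g * q + r" "r = 0 \<or> degree r < degree g"
      using polys_over_division[OF g'(1) \<open>g \<noteq> 0\<close> p(1)] by blast
    \<comment> \<open>Since p(\<alpha>) = 0, the value r(\<alpha>) = -g(\<alpha>) q(\<alpha>) is
      again a multiple of \<open>x\<close>; were it nonzero, \<open>r\<close> would beat
      \<open>g\<close>.\<close>
    have "poly r \<alpha> = 0"
    proof (rule ccontr)
      assume nz: "poly r \<alpha> \<noteq> 0"
      have "poly r \<alpha> = x * poly (- h * q) \<alpha>"
        using qr p(3) h by (simp add: algebra_simps add_eq_0_iff)
      moreover have "- h * q \<in> polys_over K"
        by (intro polys_over_mult polys_over_uminus h qr)
      ultimately have "P r" using nz qr(2) unfolding P_def by blast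
      then show False using gmin[of r] nz qr(4) by auto
    qed
    \<comment> \<open>Reducing \<open>g\<close> modulo \<open>p\<close> keeps its value at \<alpha>.
      The bound brings \<open>r\<close> below the degree of \<open>p\<close>, where minimality
      forces it to vanish.\<close>
    have "degree g \<le> degree p"
    proof -
      obtain q r where qr: "q \<in> polys_over K" "r \<in> polys_over K"
          "g = p * q + r" "r = 0 \<or> degree r < degree p"
        using polys_over_division[OF p(1,2) g'(1)] by blast
      then have eq: "poly g \<alpha> = poly r \<alpha>" using p by simp
      then have "P r" using g qr(2) unfolding P_def by metis
      moreover have "r \<noteq> 0" using eq g'(2) by auto
      ultimately show ?thesis using gmin[of r] qr(4) by auto
    qed
    then have "r = 0" using zero[OF qr(2) \<open>poly r \<alpha> = 0\<close>] qr(4) by auto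
    \<comment> \<open>Now p = g q with g(\<alpha>) nonzero, so \<open>q\<close> has the root and
      uses up the whole degree of \<open>p\<close>.\<close>
    with qr p g' have "poly q \<alpha> = 0" "q \<noteq> 0" by auto
    then have "degree p \<le> degree q" using minimal qr by auto
    moreover have "degree p = degree g + degree q"
      using qr \<open>r = 0\<close> \<open>g \<noteq> 0\<close> \<open>q \<noteq> 0\<close> by (simp add: degree_mult_eq)
    ultimately have "degree g = 0" by simp
    then obtain c where c: "g = [:c:]" by (meson degree_eq_zeroE)
    have "c \<in> K" using g' c by (auto simp: polys_over_def dest: spec[of _ 0])
    have "c \<noteq> 0" using g' c by auto
    have "c = x * poly h \<alpha>" using h c by simp
    then have "inverse x = poly ([:inverse c:] * h) \<alpha>"
      using \<open>c \<noteq> 0\<close> False by (simp add: divide_simps mult.commute)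
    moreover have "[:inverse c:] * h \<in> polys_over K"
      by (intro polys_over_mult polys_over_const inverse_mem h \<open>c \<in> K\<close>)
    ultimately show ?thesis using K'I by metis
  qed
  have K: "x \<in> K' \<and> \<tau> x = \<sigma> x" if "x \<in> K" for x
    using \<tau>[OF polys_over_const[OF that]] K'I[OF polys_over_const[OF that]] hom_zero
    by (simp add: map_poly_pCons)
  have \<alpha>: "\<alpha> \<in> K' \<and> \<tau> \<alpha> = \<beta>"
    using \<tau>[OF polys_over_X] K'I[OF polys_over_X] hom_zero hom_one
    by (simp add: map_poly_pCons)
  have "subfield_hom K' \<tau>"
  proof
    show "0 \<in> K'" "1 \<in> K'" "\<tau> 1 = 1" using K zero_mem one_mem hom_one by auto
    show "inverse x \<in> K'" if "x \<in> K'" for x using inv that .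
    show "- x \<in> K'" if x: "x \<in> K'" for x
    proof -
      obtain f where "f \<in> polys_over K" "x = poly f \<alpha>" using x by (auto simp: K'_def)
      then show ?thesis using K'I[OF polys_over_uminus, of f] by simp
    qed
    fix x y assume "x \<in> K'" "y \<in> K'"
    then obtain f g where fg: "f \<in> polys_over K" "g \<in> polys_over K" "x = poly f \<alpha>" "y = poly g \<alpha>"
      by (auto simp: K'_def)
    show "x + y \<in> K'" "x * y \<in> K'"
      using fg K'I[OF polys_over_add, of f g] K'I[OF polys_over_mult, of f g] by simp_all
    show "\<tau> (x + y) = \<tau> x + \<tau> y"
      using \<tau>[of "f + g"] fg by (simp add: polys_over_add map_poly_hom_add \<tau>)
    show "\<tau> (x * y) = \<tau> x * \<tau> y"
      using \<tau>[of "f * g"] fg by (simp add: polys_over_mult map_poly_hom_mult \<tau>)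
  qed
  with K \<alpha> show ?thesis by blast
qed

end

text \<open>Supplies the minimality hypothesis of \<open>extend_simple\<close>.\<close>

lemma exists_minimal_poly:
  assumes "p \<in> P" "p \<noteq> 0" "poly p \<alpha> = 0"
  shows "\<exists>m\<in>P. m \<noteq> 0 \<and> poly m \<alpha> = 0 \<and>
    (\<forall>h\<in>P. h \<noteq> 0 \<longrightarrow> poly h \<alpha> = 0 \<longrightarrow> degree m \<le> degree h)"
proof -
  define Q where "Q h \<longleftrightarrow> h \<in> P \<and> h \<noteq> 0 \<and> poly h \<alpha> = 0" for h
  have "Q p" using assms by (simp add: Q_def)
  then show ?thesis
    using arg_min_nat_lemma[of Q p degree] unfolding Q_def by blast
qed

text \<open>Elements are adjoined one at a time: each stays algebraic over the enlarged field, and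
  the image of its minimal polynomial has a root because the target is algebraically closed.\<close>

lemma subfield_hom_extend_finite:
  fixes \<sigma> :: "'a::field \<Rightarrow> 'b::alg_closed_field"
  assumes "subfield_hom K \<sigma>" "finite B"
    and "\<And>b. b \<in> B \<Longrightarrow> \<exists>p\<in>polys_over K. p \<noteq> 0 \<and> poly p b = 0"
  shows "\<exists>K' \<tau>. subfield_hom K' \<tau> \<and> K \<subseteq> K' \<and> B \<subseteq> K' \<and> (\<forall>x\<in>K. \<tau> x = \<sigma> x)"
  using assms(2,3)
proof (induction B)
  case empty
  then show ?case using assms(1) by blast
next
  case (insert b B)
  then obtain K' \<tau> where K': "subfield_hom K' \<tau>" "K \<subseteq> K'" "B \<subseteq> K'" "\<forall>x\<in>K. \<tau> x = \<sigma> x"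
    by (meson insert_iff)
  interpret K': subfield_hom K' \<tau> by fact
  obtain p where "p \<in> polys_over K" and p: "p \<noteq> 0" "poly p b = 0" using insert.prems by blast
  with K'(2) have "p \<in> polys_over K'" by (auto simp: polys_over_def)
  then obtain m where m: "m \<in> polys_over K'" "m \<noteq> 0" "poly m b = 0"
    "\<forall>h\<in>polys_over K'. h \<noteq> 0 \<longrightarrow> poly h b = 0 \<longrightarrow> degree m \<le> degree h"
    using exists_minimal_poly[OF _ p] by blast
  have "degree m > 0"
  proof (rule ccontr)
    assume "\<not> degree m > 0"
    then obtain c where "m = [:c:]" by (meson degree_eq_zeroE gr0I)
    with m show False by simp
  qed
  \<comment> \<open>Injectivity on \<open>K'\<close> keeps the leading coefficient, so the image is
    not constant.\<close>
  moreover have "degree (map_poly \<tau> m) = degree m"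
  proof (rule map_poly_degree_eq)
    have "lead_coeff m \<in> K'" using m by (auto simp: polys_over_def)
    then show "\<tau> (lead_coeff m) \<noteq> 0" using m by (simp add: K'.hom_eq_0_iff)
  qed
  ultimately obtain \<beta> where \<beta>: "poly (map_poly \<tau> m) \<beta> = 0"
    using alg_closed_imp_poly_has_root[of "map_poly \<tau> m"] by auto
  have "\<exists>L \<rho>. subfield_hom L \<rho> \<and> K' \<subseteq> L \<and> b \<in> L \<and> \<rho> b = \<beta> \<and> (\<forall>x\<in>K'. \<rho> x = \<tau> x)"
    by (rule K'.extend_simple[OF m(1-3) _ \<beta>]) (use m(4) in simp)
  then obtain L \<rho> where "subfield_hom L \<rho>" "K' \<subseteq> L" "b \<in> L" "\<forall>x\<in>K'. \<rho> x = \<tau> x"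
    by (elim exE conjE)
  then show ?case using K'(2-4) by (intro exI[of _ L] exI[of _ \<rho>]) auto
qed

section \<open>Kronecker's theorem on roots of unity\<close>

abbreviation complex_poly :: "int poly \<Rightarrow> complex poly" where
  "complex_poly \<equiv> map_poly of_int"

lemma complex_poly_mult: "complex_poly (p * q) = complex_poly p * complex_poly q"
  using ring_hom_on.map_poly_hom_mult[OF ring_hom_on_of_int, of p q] by simp

lemma complex_poly_add: "complex_poly (p + q) = complex_poly p + complex_poly q"
  using ring_hom_on.map_poly_hom_add[OF ring_hom_on_of_int, of p q] by simp

lemma degree_complex_poly [simp]: "degree (complex_poly p) = degree p"
  by (cases "p = 0") (auto intro: map_poly_degree_eq)

lemma coeff_complex_poly [simp]: "coeff (complex_poly p) i = of_int (coeff p i)"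
  by (simp add: coeff_map_poly)

lemma complex_poly_eq_0_iff [simp]: "complex_poly p = 0 \<longleftrightarrow> p = 0"
  by (simp add: poly_eq_iff)

text \<open>Split off a factor x - a with |a| at most 1: every coefficient is a coefficient of the
  quotient minus \<open>a\<close> times another, so the bound at most doubles with each
  degree.\<close>

lemma coeff_bound_roots_in_disc:
  fixes p :: "complex poly"
  assumes "lead_coeff p = 1" and "\<And>x. poly p x = 0 \<Longrightarrow> cmod x \<le> 1"
  shows "cmod (coeff p i) \<le> 2 ^ degree p"
  using assms
proof (induction "degree p" arbitrary: p i)
  case 0
  then obtain c where "p = [:c:]" by (metis degree_eq_zeroE)
  with 0 show ?case by (cases i) auto
next
  case (Suc n)
  then obtain a where a: "poly p a = 0"
    using alg_closed_imp_poly_has_root[of p] by auto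
  then obtain q where q: "p = [:- a, 1:] * q"
    by (metis poly_eq_0_iff_dvd dvdE)
  have "p \<noteq> 0" using Suc by auto
  then have "q \<noteq> 0" using q by auto
  have deg: "degree p = Suc (degree q)"
    using q \<open>q \<noteq> 0\<close> degree_mult_eq[of "[:- a, 1:]" q] by simp
  have lc: "lead_coeff q = 1"
    using Suc.prems(1) q lead_coeff_mult[of "[:- a, 1:]" q] by simp
  have IH: "cmod (coeff q j) \<le> 2 ^ n" for j
    using Suc.hyps(1)[of q j] Suc.hyps(2) deg lc Suc.prems(2) q by simp
  have "cmod a \<le> 1" using Suc.prems(2) a by blast
  have "coeff p i = (case i of 0 \<Rightarrow> 0 | Suc j \<Rightarrow> coeff q j) - a * coeff q i"
    unfolding q by (simp add: coeff_pCons split: nat.split)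
  then have "cmod (coeff p i) \<le> cmod (case i of 0 \<Rightarrow> 0 | Suc j \<Rightarrow> coeff q j) + cmod (a * coeff q i)"
    using norm_triangle_ineq4 by metis
  also have "\<dots> \<le> 2 ^ n + 1 * 2 ^ n"
    unfolding norm_mult using IH \<open>cmod a \<le> 1\<close>
    by (intro add_mono mult_mono) (auto split: nat.split)
  finally show ?case using Suc.hyps(2)[symmetric] by simp
qed

lemma finite_bounded_int_polys:
  "finite {p :: int poly. degree p = d \<and> (\<forall>i. \<bar>coeff p i\<bar> \<le> C)}"
proof (rule finite_subset)
  show "{p :: int poly. degree p = d \<and> (\<forall>i. \<bar>coeff p i\<bar> \<le> C)}
      \<subseteq> Poly ` {xs. set xs \<subseteq> {-C..C} \<and> length xs = Suc d}"
  proof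
    fix p :: "int poly" assume p: "p \<in> {p. degree p = d \<and> (\<forall>i. \<bar>coeff p i\<bar> \<le> C)}"
    have "p = Poly (map (coeff p) [0..<Suc d])"
    proof (rule poly_eqI)
      fix i
      show "coeff p i = coeff (Poly (map (coeff p) [0..<Suc d])) i"
        using p by (auto simp: nth_default_def coeff_eq_0 simp del: upt_Suc)
    qed
    moreover have "set (map (coeff p) [0..<Suc d]) \<subseteq> {-C..C}"
      using p by (auto simp: abs_le_iff minus_le_iff simp del: upt_Suc)
    ultimately show "p \<in> Poly ` {xs. set xs \<subseteq> {-C..C} \<and> length xs = Suc d}"
      by (intro image_eqI[of _ _ "map (coeff p) [0..<Suc d]"]) (auto simp del: upt_Suc)
  qed
qed (intro finite_imageI finite_lists_length_eq, simp)

text \<open>The class on which Kronecker's argument runs: for each degree it is finite, and it is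
  closed under squaring all roots.\<close>

definition unit_circle_polys :: "nat \<Rightarrow> int poly set" where
  "unit_circle_polys d = {p. degree p = d \<and> lead_coeff p = 1 \<and>
     (\<forall>x. poly (complex_poly p) x = 0 \<longrightarrow> cmod x = 1)}"

lemma finite_unit_circle_polys: "finite (unit_circle_polys d)"
proof (rule finite_subset[OF _ finite_bounded_int_polys[of d "2 ^ d"]], rule subsetI)
  fix p assume p: "p \<in> unit_circle_polys d"
  have "\<bar>coeff p i\<bar> \<le> 2 ^ d" for i
  proof -
    have "cmod (coeff (complex_poly p) i) \<le> 2 ^ degree (complex_poly p)"
      using p by (intro coeff_bound_roots_in_disc) (auto simp: unit_circle_polys_def)
    then have "real_of_int \<bar>coeff p i\<bar> \<le> of_int (2 ^ d)"
      using p by (simp add: unit_circle_polys_def)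
    then show ?thesis by (simp only: of_int_le_iff)
  qed
  then show "p \<in> {p. degree p = d \<and> (\<forall>i. \<bar>coeff p i\<bar> \<le> 2 ^ d)}"
    using p by (auto simp: unit_circle_polys_def)
qed

text \<open>Multiplication by x swaps the even and the odd part, which drives the induction.\<close>

lemma poly_even_odd_decomposition:
  fixes p :: "'a::comm_ring_1 poly"
  shows "\<exists>e f. p = pcompose e [:0, 0, 1:] + [:0, 1:] * pcompose f [:0, 0, 1:]"
proof (induction p)
  case 0
  show ?case by (intro exI[of _ 0]) simp
next
  case (pCons a p)
  then obtain e f where ef: "p = pcompose e [:0, 0, 1:] + [:0, 1:] * pcompose f [:0, 0, 1:]" by blast
  have "pCons a p = [:a:] + [:0, 1:] * p" by simp
  also have "\<dots> = pcompose (pCons a f) [:0, 0, 1:] + [:0, 1:] * pcompose e [:0, 0, 1:]"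
    unfolding ef by (simp add: pcompose_pCons algebra_simps)
  finally show ?case by blast
qed

text \<open>Graeffe's root-squaring step: \<open>q(x\<^sup>2) = \<plusminus> p(x) p(-x)\<close>.\<close>
lemma root_squaring:
  assumes "p \<in> unit_circle_polys d"
  shows "\<exists>q\<in>unit_circle_polys d. \<forall>z. poly (complex_poly p) z = 0 \<longrightarrow> poly (complex_poly q) (z\<^sup>2) = 0"
proof -
  obtain e f where ef: "p = pcompose e [:0, 0, 1:] + [:0, 1:] * pcompose f [:0, 0, 1:]"
    using poly_even_odd_decomposition by blast
  \<comment> \<open>From p(x) = e(x^2) + x f(x^2) follows p(x) p(-x) = e(x^2)^2 - x^2 f(x^2)^2, a
    polynomial in x^2; the sign makes it monic.\<close>
  define q where "q = smult ((-1) ^ d) (e\<^sup>2 - [:0, 1:] * f\<^sup>2)"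
  have deg: "degree p = d" and lc: "lead_coeff p = 1" using assms by (auto simp: unit_circle_polys_def)
  define p' where "p' = pcompose p [:0, -1:]"
  have sq: "pcompose [:0, 0, 1:] [:0, - 1 :: int:] = [:0, 0, 1:]"
    by (simp add: pcompose_pCons)
  have p': "p' = pcompose e [:0, 0, 1:] - [:0, 1:] * pcompose f [:0, 0, 1:]"
    unfolding p'_def by (subst ef)
      (simp add: pcompose_add pcompose_mult pcompose_assoc[symmetric] sq pcompose_pCons[of 0])
  have q: "pcompose q [:0, 0, 1:] = smult ((-1) ^ d) (p * p')"
  proof -
    define E F X where "E = pcompose e [:0, 0, 1:]" and "F = pcompose f [:0, 0, 1:]" and "X = [:0, 1 :: int:]"
    have "pcompose X [:0, 0, 1:] = X * X" by (simp add: X_def pcompose_pCons)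
    then have "pcompose q [:0, 0, 1:] = smult ((-1) ^ d) (E * E - X * X * (F * F))"
      by (simp add: q_def E_def F_def X_def[symmetric] pcompose_smult pcompose_diff pcompose_mult power2_eq_square)
    also have "E * E - X * X * (F * F) = (E + X * F) * (E - X * F)"
      by (simp add: algebra_simps)
    also have "\<dots> = p * p'" unfolding p' by (subst ef) (simp add: E_def F_def X_def)
    finally show ?thesis .
  qed
  have deg': "degree p' = d" by (simp add: p'_def degree_pcompose deg)
  have lc': "lead_coeff p' = (-1) ^ d"
    unfolding p'_def using lc deg by (subst lead_coeff_comp) auto
  have "p \<noteq> 0" "p' \<noteq> 0" using lc lc' by auto
  have "degree q * 2 = 2 * d"
    using arg_cong[OF q, of degree] \<open>p \<noteq> 0\<close> \<open>p' \<noteq> 0\<close>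
    by (simp add: degree_pcompose degree_mult_eq deg deg')
  then have "degree q = d" by simp
  moreover have "lead_coeff q = lead_coeff (pcompose q [:0, 0, 1:])"
    by (subst lead_coeff_comp) auto
  then have "lead_coeff q = 1"
    unfolding q using lead_coeff_mult[of p p'] lc lc' by (simp add: power_mult_distrib[symmetric])
  moreover have ev: "poly (complex_poly q) (z\<^sup>2) =
      (-1) ^ d * (poly (complex_poly p) z * poly (complex_poly p) (- z))" for z
  proof -
    interpret ring_hom_on UNIV "of_int :: int \<Rightarrow> complex" by (rule ring_hom_on_of_int)
    have comp: "complex_poly (pcompose a b) = pcompose (complex_poly a) (complex_poly b)" for a b
      by (induction a) (simp_all add: pcompose_pCons map_poly_hom_add map_poly_hom_mult map_poly_pCons)
    have "poly (complex_poly (pcompose q [:0, 0, 1:])) z = poly (complex_poly q) (z\<^sup>2)"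
      by (simp add: comp poly_pcompose map_poly_pCons power2_eq_square)
    moreover have "poly (complex_poly p') z = poly (complex_poly p) (- z)"
      by (simp add: p'_def comp poly_pcompose map_poly_pCons)
    ultimately show ?thesis
      by (simp add: q map_poly_hom_mult map_poly_smult)
  qed
  moreover have "cmod x = 1" if "poly (complex_poly q) x = 0" for x
  proof -
    \<comment> \<open>A root of \<open>q\<close> is the square of a root of \<open>p\<close>, namely
      of one of its own two square roots.\<close>
    have "poly (complex_poly p) (csqrt x) = 0 \<or> poly (complex_poly p) (- csqrt x) = 0"
      using ev[of "csqrt x"] that by simp
    then have "cmod (csqrt x) = 1"
      using assms by (auto simp: unit_circle_polys_def)
    then show ?thesis by (metis norm_power power2_csqrt power_one)
  qed
  ultimately show ?thesis by (intro bexI[of _ q]) (auto simp: unit_circle_polys_def)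
qed

text \<open>The iterated squares of \<open>z\<close> are all roots of members of a finite class,
  hence take finitely many values; two of them agree, and cancelling gives a power equal to
  1.\<close>

lemma kronecker_root_of_unity:
  assumes "p \<in> unit_circle_polys d" "poly (complex_poly p) z = 0"
  shows "\<exists>n>0. z ^ n = 1"
proof -
  define S where "S = (\<Union>p\<in>unit_circle_polys d. {x. poly (complex_poly p) x = 0})"
  have "finite S"
    unfolding S_def
    by (intro finite_UN_I finite_unit_circle_polys poly_roots_finite) (auto simp: unit_circle_polys_def)
  have "\<exists>q\<in>unit_circle_polys d. poly (complex_poly q) (z ^ 2 ^ k) = 0" for k :: nat
  proof (induction k)
    case (Suc k)
    then show ?case using root_squaring[of _ d] by (metis power_Suc2 power_mult)
  qed (use assms in auto)
  then have "range (\<lambda>k::nat. z ^ 2 ^ k) \<subseteq> S" by (auto simp: S_def)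
  then have "\<not> inj (\<lambda>k::nat. z ^ 2 ^ k)"
    using \<open>finite S\<close> finite_imageD finite_subset infinite_UNIV_nat by blast
  then obtain k l :: nat where "k < l" "z ^ 2 ^ k = z ^ 2 ^ l"
    unfolding inj_def by (metis nat_neq_iff)
  moreover have "z \<noteq> 0" using assms by (auto simp: unit_circle_polys_def)
  moreover have "(2::nat) ^ k < 2 ^ l" using \<open>k < l\<close> by simp
  moreover have "z ^ 2 ^ l = z ^ 2 ^ k * z ^ (2 ^ l - 2 ^ k)"
    using \<open>(2::nat) ^ k < 2 ^ l\<close> by (simp flip: power_add)
  ultimately show ?thesis by (intro exI[of _ "2 ^ l - 2 ^ k"]) auto
qed

text \<open>Gauss's lemma: an algebraic integer has a monic integer polynomial that is minimal even
  among rational ones. Minimality over the rationals is the form that \<open>extend_simple\<close>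
  consumes.\<close>

lemma minimal_int_poly:
  fixes z :: complex
  assumes f: "lead_coeff f = 1" "poly (complex_poly f) z = 0"
  obtains p where "lead_coeff p = 1" "poly (complex_poly p) z = 0"
    "\<And>h. \<lbrakk>h \<in> polys_over \<rat>; h \<noteq> 0; poly h z = 0\<rbrakk> \<Longrightarrow> degree p \<le> degree h"
proof -
  define P where "P h \<longleftrightarrow> h \<noteq> 0 \<and> poly (complex_poly h) z = 0" for h
  have "P f" using f by (auto simp: P_def)
  define m where "m = arg_min degree P"
  have m: "P m" and min: "\<And>h. P h \<Longrightarrow> degree m \<le> degree h"
    using arg_min_nat_lemma[of P f degree] \<open>P f\<close> by (auto simp: m_def)
  define p where "p = primitive_part m"
  have mp: "m = smult (Polynomial.content m) p" by (simp add: p_def)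
  have "m \<noteq> 0" using m by (simp add: P_def)
  then have "Polynomial.content m \<noteq> 0" by simp
  have deg: "degree m = degree p" using mp \<open>Polynomial.content m \<noteq> 0\<close> by (metis degree_smult_eq)
  have cont: "Polynomial.content p = 1" using \<open>m \<noteq> 0\<close> by (simp add: p_def)
  have "p \<noteq> 0" using cont by auto
  have "complex_poly m = smult (of_int (Polynomial.content m)) (complex_poly p)"
    by (subst mp) (simp add: map_poly_smult)
  then have pz: "poly (complex_poly p) z = 0"
    using m \<open>Polynomial.content m \<noteq> 0\<close> \<open>m \<noteq> 0\<close> by (simp add: P_def)
  have minp: "degree p \<le> degree h" if "h \<noteq> 0" "poly (complex_poly h) z = 0" for h
    using min[of h] that deg by (simp add: P_def)
  have "is_unit (lead_coeff p)"
  proof -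
    \<comment> \<open>Over the integers only a multiple \<open>c\<close> of \<open>f\<close> can be
      divided by \<open>p\<close>. The remainder vanishes by minimality, and as \<open>p\<close> has
      content 1 the factor \<open>c\<close> divides \<open>q\<close>; hence \<open>p\<close> divides
      the monic \<open>f\<close>.\<close>
    obtain q r where qr: "pseudo_divmod f p = (q, r)" by fastforce
    define c where "c = lead_coeff p ^ (Suc (degree f) - degree p)"
    have "c \<noteq> 0" using \<open>p \<noteq> 0\<close> by (simp add: c_def)
    have eq: "smult c f = p * q + r" and r: "r = 0 \<or> degree r < degree p"
      using pseudo_divmod[OF \<open>p \<noteq> 0\<close> qr] by (auto simp: c_def)
    have "complex_poly (smult c f) = complex_poly p * complex_poly q + complex_poly r"
      unfolding eq by (simp add: complex_poly_add complex_poly_mult)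
    then have "poly (complex_poly r) z = 0"
      using pz f by (simp add: map_poly_smult) (metis add_0 mult_zero_left mult_zero_right poly_add poly_mult poly_smult)
    then have "r = 0" using r minp[of r] by (cases "r = 0") auto
    then have "smult c f = p * q" using eq by simp
    then have "Polynomial.content q = normalize c * Polynomial.content f"
      using cont by (metis content_mult content_smult mult_1)
    then have "c dvd Polynomial.content q" by simp
    then have "[:c:] dvd q" by (simp add: const_poly_dvd_iff_dvd_content)
    then obtain q' where "q = smult c q'" by (auto elim: dvdE)
    then have "smult c f = smult c (p * q')" using \<open>smult c f = p * q\<close> by simp
    then have "f = p * q'" using \<open>c \<noteq> 0\<close> by (simp add: poly_eq_iff)
    then show ?thesis using f(1) lead_coeff_mult[of p q'] by (metis dvdI)
  qed
  define u where "u = lead_coeff p"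
  have u: "u = 1 \<or> u = -1" using \<open>is_unit (lead_coeff p)\<close> by (auto simp: u_def)
  then have lc: "lead_coeff (smult u p) = 1" unfolding u_def by auto
  show thesis
  proof (rule that[of "smult u p"])
    show "poly (complex_poly (smult u p)) z = 0"
      using pz by (simp add: map_poly_smult)
    fix h :: "complex poly" assume h: "h \<in> polys_over \<rat>" "h \<noteq> 0" "poly h z = 0"
    \<comment> \<open>A common denominator of the coefficients of \<open>h\<close>, built up one
      coefficient at a time.\<close>
    have "\<exists>d::int. d \<noteq> 0 \<and> (\<forall>i\<in>I. of_int d * coeff h i \<in> \<int>)" if "finite I" for I
      using that
    proof (induction I)
      case empty
      show ?case by (intro exI[of _ 1]) auto
    next
      case (insert j I)
      then obtain d :: int where d: "d \<noteq> 0" "\<forall>i\<in>I. of_int d * coeff h i \<in> \<int>" by blast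
      have "coeff h j \<in> \<rat>" using h by (simp add: polys_over_def)
      then obtain a b :: int where ab: "b \<noteq> 0" "coeff h j = of_int a / of_int b"
        by (metis Rats_cases' less_irrefl)
      have "of_int (d * b) * coeff h j = of_int (d * a)" using ab by simp
      moreover have "of_int (d * b) * coeff h i = of_int b * (of_int d * coeff h i)" for i by simp
      ultimately show ?case
        using d ab by (intro exI[of _ "d * b"]) (metis Ints_mult Ints_of_int insert_iff mult_eq_0_iff)
    qed
    from this[of "{..degree h}"] obtain d :: int
      where d: "d \<noteq> 0" "\<forall>i\<le>degree h. of_int d * coeff h i \<in> \<int>" by auto
    \<comment> \<open>The scaled coefficients are integers inside the complex numbers; the floor of
      the real part reads them off.\<close>
    define g where "g = map_poly (\<lambda>x. \<lfloor>Re x\<rfloor>) (smult (of_int d) h)"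
    have "complex_poly g = smult (of_int d) h"
    proof (rule poly_eqI)
      fix i
      have "of_int d * coeff h i \<in> \<int>"
        using d by (cases "i \<le> degree h") (auto simp: coeff_eq_0)
      then have "complex_of_int \<lfloor>Re (of_int d * coeff h i)\<rfloor> = of_int d * coeff h i"
        by (auto elim!: Ints_cases simp del: times_complex.sel)
      then show "coeff (complex_poly g) i = coeff (smult (of_int d) h) i"
        by (simp add: g_def coeff_map_poly del: times_complex.sel)
    qed
    then have "g \<noteq> 0" "poly (complex_poly g) z = 0" "degree h = degree g"
      using h d by (auto simp flip: degree_complex_poly complex_poly_eq_0_iff)
    then show "degree (smult u p) \<le> degree h"
      using minp[of g] u by auto
  qed (rule lc)
qed

text \<open>By Kronecker some root \<beta> of the minimal polynomial of \<open>z\<close> lies off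
  the circle. Sending \<open>z\<close> to \<beta> extends the identity of the rationals, first to
  Q(z) and then to a field containing \<open>B\<close>.\<close>

lemma exists_embedding_off_unit_circle:
  fixes z :: complex
  assumes f: "lead_coeff f = 1" "poly (complex_poly f) z = 0"
    and nu: "\<And>n. n > 0 \<Longrightarrow> z ^ n \<noteq> 1"
    and B: "finite B" "z \<in> B" "\<And>b. b \<in> B \<Longrightarrow> \<exists>p. p \<noteq> 0 \<and> poly (complex_poly p) b = 0"
  obtains K and \<sigma> :: "complex \<Rightarrow> complex"
    where "subfield_hom K \<sigma>" "B \<subseteq> K" "\<And>n. \<sigma> (of_int n) = of_int n" "\<And>n. of_int n \<in> K"
      "cmod (\<sigma> z) \<noteq> 1"
proof -
  obtain p where p: "lead_coeff p = 1" "poly (complex_poly p) z = 0"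
    "\<And>h. \<lbrakk>h \<in> polys_over \<rat>; h \<noteq> 0; poly h z = 0\<rbrakk> \<Longrightarrow> degree p \<le> degree h"
    using minimal_int_poly[OF f] by blast
  have "p \<notin> unit_circle_polys (degree p)"
    using kronecker_root_of_unity p nu by blast
  then obtain \<beta> where \<beta>: "poly (complex_poly p) \<beta> = 0" "cmod \<beta> \<noteq> 1"
    using p by (auto simp: unit_circle_polys_def)
  interpret Q: subfield_hom "\<rat> :: complex set" "\<lambda>x::complex. x"
    by unfold_locales auto
  have over: "complex_poly q \<in> polys_over \<rat>" for q by (simp add: polys_over_def)
  have "p \<noteq> 0" using p by auto
  obtain K \<tau> where K: "subfield_hom K \<tau>" "\<rat> \<subseteq> K" "z \<in> K" "\<tau> z = \<beta>" "\<forall>x\<in>\<rat>. \<tau> x = x"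
    using Q.extend_simple[of "complex_poly p" z \<beta>] over p \<beta> \<open>p \<noteq> 0\<close> by auto
  have "complex_poly q \<in> polys_over K" for q using K(2) by (auto simp: polys_over_def)
  then have "\<exists>p\<in>polys_over K. p \<noteq> 0 \<and> poly p b = 0" if "b \<in> B" for b
    using B(3)[OF that] by (metis complex_poly_eq_0_iff)
  then obtain L \<sigma> where L: "subfield_hom L \<sigma>" "K \<subseteq> L" "B \<subseteq> L" "\<forall>x\<in>K. \<sigma> x = \<tau> x"
    using subfield_hom_extend_finite[OF K(1) B(1)] by blast
  show thesis
  proof (rule that[OF L(1,3)])
    show "cmod (\<sigma> z) \<noteq> 1" using L K \<beta> by auto
    show "\<sigma> (of_int n) = of_int n" "of_int n \<in> L" for n
      using subsetD[OF K(2) Rats_of_int] subsetD[OF L(2)] bspec[OF K(5) Rats_of_int] L(4) by simp_all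
  qed
qed

section \<open>Counting quotients of roots\<close>

text \<open>\<open>\<sigma>\<close> fixes the coefficients of \<open>f\<close>, so every root in
  \<open>K\<close> yields a second one; the second is new whenever the first is on the unit circle
  and its image is not.\<close>

lemma card_le_of_ratios_roots:
  assumes B: "finite B" "1 \<in> B" "\<And>z. z \<in> B \<Longrightarrow> cmod z = 1"
    and f: "f \<noteq> 0" "\<And>z w. \<lbrakk>z \<in> B; w \<in> B; z \<noteq> w\<rbrakk> \<Longrightarrow> poly (complex_poly f) (z / w) = 0"
    and hom: "subfield_hom K \<sigma>" "B \<subseteq> K" "\<And>n. \<sigma> (of_int n) = of_int n" "\<And>n. of_int n \<in> K"
    and z: "z \<in> B" "cmod (\<sigma> z) \<noteq> 1"
  shows "5 * card B \<le> 2 * degree f + 2"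
proof -
  interpret subfield_hom K \<sigma> by (fact hom(1))
  define \<phi> where "\<phi> w = cmod (\<sigma> w)" for w
  have nz: "w \<noteq> 0" if "w \<in> B" for w using B(3)[OF that] by auto
  have BK: "w \<in> K" if "w \<in> B" for w using that hom(2) by blast
  have pos: "\<phi> w > 0" if "w \<in> B" for w
    using nz[OF that] BK[OF that] by (simp add: \<phi>_def hom_eq_0_iff)
  have div: "\<phi> (v / w) = \<phi> v / \<phi> w" if "v \<in> B" "w \<in> B" for v w
    using BK that by (simp add: \<phi>_def hom_divide norm_divide)
  have "B \<noteq> {}" using B by auto
  have fin: "finite (\<phi> ` B)" "\<phi> ` B \<noteq> {}" using B by auto
  define lo where "lo = Min (\<phi> ` B)"
  define hi where "hi = Max (\<phi> ` B)"
  have lohi: "lo \<le> \<phi> w" "\<phi> w \<le> hi" if "w \<in> B" for w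
    using that fin by (auto simp: lo_def hi_def)
  \<comment> \<open>\<open>\<phi>\<close> is 1 at the element 1 but not at \<open>z\<close>.\<close>
  have "lo \<noteq> hi"
    using lohi[OF B(2)] lohi[OF z(1)] z(2) by (auto simp: \<phi>_def hom_one)
  define F where "F c = {w \<in> B. \<phi> w = c}" for c
  have "card (F lo) + card (F hi) = card (F lo \<union> F hi)"
    using \<open>lo \<noteq> hi\<close> B(1) by (subst card_Un_disjoint) (auto simp: F_def)
  also have "\<dots> \<le> card B" using B(1) by (intro card_mono) (auto simp: F_def)
  \<comment> \<open>The two extreme level sets are disjoint, so one of them has at most half of the
    elements.\<close>
  finally have "2 * card (F lo) \<le> card B \<or> 2 * card (F hi) \<le> card B" by linarith
  moreover have "lo \<in> \<phi> ` B" "hi \<in> \<phi> ` B" using fin by (auto simp: lo_def hi_def intro: Min_in Max_in)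
  ultimately obtain b where b: "b \<in> B" "2 * card (F (\<phi> b)) \<le> card B" "\<phi> b = lo \<or> \<phi> b = hi" by auto
  define F\<^sub>0 where "F\<^sub>0 = F (\<phi> b)"
  define R where "R = B - F\<^sub>0"
  have "F\<^sub>0 \<subseteq> B" "b \<in> F\<^sub>0" "finite F\<^sub>0" "finite R" using b B(1) by (auto simp: F\<^sub>0_def R_def F_def)
  have cardR: "card R + card F\<^sub>0 = card B"
    unfolding R_def using \<open>F\<^sub>0 \<subseteq> B\<close> \<open>finite F\<^sub>0\<close> B(1)
    by (simp add: card_Diff_subset card_mono)
  \<comment> \<open>Extremality of \<open>b\<close> puts all of \<open>R\<close> on one side, so
    \<open>\<phi>\<close> separates the quotients w/b from the quotients b/w, on opposite sides of
    1.\<close>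
  have R: "(\<forall>w\<in>R. \<phi> w > \<phi> b) \<or> (\<forall>w\<in>R. \<phi> w < \<phi> b)"
    using b(3)
  proof
    assume "\<phi> b = lo"
    then show ?thesis using lohi(1) by (auto simp: R_def F\<^sub>0_def F_def less_le)
  next
    assume "\<phi> b = hi"
    then show ?thesis using lohi(2) by (force simp: R_def F\<^sub>0_def F_def less_le)
  qed
  have RB: "w \<in> B" "\<phi> w \<noteq> \<phi> b" "w \<noteq> b" if "w \<in> R" for w
    using that by (auto simp: R_def F\<^sub>0_def F_def b(1))
  \<comment> \<open>Within the level set only w/b is taken: there b/w may coincide with another such
    quotient, and \<open>\<phi>\<close> cannot tell them apart.\<close>
  define E0 where "E0 = (\<lambda>w. w / b) ` (F\<^sub>0 - {b})"
  define E1 where "E1 = (\<lambda>w. w / b) ` R"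
  define E2 where "E2 = (\<lambda>w. b / w) ` R"
  have fins: "finite E0" "finite E1" "finite E2"
    using \<open>finite F\<^sub>0\<close> \<open>finite R\<close> by (auto simp: E0_def E1_def E2_def)
  have cards: "card E0 + 1 = card F\<^sub>0" "card E1 = card R" "card E2 = card R"
  proof -
    have inj: "inj_on (\<lambda>w. w / b) X" for X using nz[OF b(1)] by (auto simp: inj_on_def)
    show "card E0 + 1 = card F\<^sub>0"
      unfolding E0_def card_image[OF inj]
      using card_Suc_Diff1[OF \<open>finite F\<^sub>0\<close> \<open>b \<in> F\<^sub>0\<close>] by simp
    show "card E1 = card R" unfolding E1_def by (intro card_image inj)
    have "inj_on (\<lambda>w. b / w) R"
      using nz[OF b(1)] nz RB by (auto simp: inj_on_def field_simps)
    then show "card E2 = card R" unfolding E2_def by (rule card_image)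
  qed
  have sub: "E0 \<union> E1 \<union> E2 \<subseteq> K"
    using BK b(1) RB \<open>F\<^sub>0 \<subseteq> B\<close> by (auto simp: E0_def E1_def E2_def intro!: divide_mem)
  have \<phi>E: "\<phi> x = 1" if "x \<in> E0" for x
    using that \<open>F\<^sub>0 \<subseteq> B\<close> pos[OF b(1)] b(1) div by (fastforce simp: E0_def F\<^sub>0_def F_def)
  have \<phi>12: "\<phi> x \<noteq> 1" "\<phi> y \<noteq> 1" "\<phi> x \<noteq> \<phi> y" if xy: "x \<in> E1" "y \<in> E2" for x y
  proof -
    obtain v w where vw: "v \<in> R" "w \<in> R" "x = v / b" "y = b / w"
      using xy by (auto simp: E1_def E2_def)
    have "\<phi> x > 1 \<and> \<phi> y < 1 \<or> \<phi> x < 1 \<and> \<phi> y > 1"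
      using R vw RB b(1) pos by (auto simp: div)
    then show "\<phi> x \<noteq> 1" "\<phi> y \<noteq> 1" "\<phi> x \<noteq> \<phi> y" by auto
  qed
  \<comment> \<open>\<open>\<phi>12\<close> needs a point of each set even to speak of one; this
    provides the other point.\<close>
  have E12_empty: "E1 = {} \<longleftrightarrow> E2 = {}" by (auto simp: E1_def E2_def)
  have disj: "E0 \<inter> E1 = {}" "E0 \<inter> E2 = {}" "E1 \<inter> E2 = {}"
    using \<phi>E \<phi>12 E12_empty by (blast, blast, blast)
  have cmod1: "cmod x = 1" if "x \<in> E0 \<union> E1 \<union> E2" for x
    using that B(3) b(1) RB \<open>F\<^sub>0 \<subseteq> B\<close> by (auto simp: E0_def E1_def E2_def norm_divide)
  have root: "poly (complex_poly f) x = 0" if "x \<in> E0 \<union> E1 \<union> E2" for x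
    using that f(2) b(1) RB \<open>F\<^sub>0 \<subseteq> B\<close> by (fastforce simp: E0_def E1_def E2_def)
  have fK: "complex_poly f \<in> polys_over K" using hom(4) by (simp add: polys_over_def)
  have "map_poly \<sigma> (complex_poly f) = complex_poly f"
    by (rule poly_eqI) (simp add: coeff_map_poly_hom hom(3))
  then have root': "poly (complex_poly f) (\<sigma> x) = 0" if "x \<in> E0 \<union> E1 \<union> E2" for x
    using poly_map_poly_hom[OF fK, of x] root[OF that] that sub hom_zero by auto
  define U where "U = E0 \<union> E1 \<union> E2"
  \<comment> \<open>Only \<open>E1\<close> and \<open>E2\<close> are transported: the images of
    \<open>E0\<close> stay on the unit circle, where they may fall into \<open>U\<close>.\<close>
  define V where "V = \<sigma> ` (E1 \<union> E2)"
  have c12: "card (E1 \<union> E2) = 2 * card R"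
    using cards disj fins by (simp add: card_Un_disjoint)
  have "card U = card E0 + 2 * card R"
    unfolding U_def using c12 cards disj fins
    by (simp add: card_Un_disjoint Un_assoc Int_Un_distrib)
  moreover have "card V = 2 * card R"
    unfolding V_def c12[symmetric] by (rule card_image, rule inj_on_subset[OF hom_inj]) (use sub in auto)
  moreover have "U \<inter> V = {}"
  proof -
    have "cmod y \<noteq> 1" if "y \<in> V" for y
    proof -
      obtain x where "x \<in> E1 \<union> E2" "y = \<sigma> x" using \<open>y \<in> V\<close> by (auto simp: V_def)
      then show ?thesis using \<phi>12 E12_empty unfolding \<phi>_def by blast
    qed
    then show ?thesis using cmod1 by (auto simp: U_def)
  qed
  moreover have "finite U" "finite V" using fins by (auto simp: U_def V_def)
  ultimately have "card (U \<union> V) = card E0 + 4 * card R" by (simp add: card_Un_disjoint)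
  moreover have "U \<union> V \<subseteq> {x. poly (complex_poly f) x = 0}"
    using root root' by (auto simp: U_def V_def)
  then have "card (U \<union> V) \<le> degree f"
    using card_mono[OF poly_roots_finite, of "complex_poly f" "U \<union> V"]
      card_poly_roots_bound[of "complex_poly f"] f(1) by simp
  \<comment> \<open>With n = |B| and k = |F|, the count is (k - 1) + 4(n - k) = 4n - 3k - 1, and 2k
    is at most n.\<close>
  ultimately show ?thesis
    using cards(1) cardR b(2) unfolding F\<^sub>0_def[symmetric] by linarith
qed

section \<open>Spectra of unions of unit cells\<close>

lemma norm_expo [simp]: "cmod (expo l x) = 1"
  by (simp add: expo_def norm_exp_eq_Re)

lemma expo_0 [simp]: "expo 0 x = 1"
  by (simp add: expo_def)

lemma expo_add_right: "expo l (x + y) = expo l x * expo l y"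
  by (simp add: expo_def algebra_simps flip: exp_add)

lemma expo_nat: "expo l (real n) = expo l 1 ^ n"
  by (simp add: expo_def algebra_simps flip: exp_of_nat_mult)

lemma expo_mult_cnj: "expo l x * cnj (expo m x) = expo (l - m) x"
  by (simp add: expo_def algebra_simps exp_cnj flip: exp_add)

lemma expo_diff_left: "expo (l - m) x = expo l x / expo m x"
  by (simp add: expo_def algebra_simps flip: exp_diff)

lemma continuous_on_expo: "continuous_on S (expo l)"
  unfolding expo_def by (intro continuous_intros)

lemma rational_of_expo_root_of_unity:
  assumes "n > 0" "expo l 1 ^ n = 1"
  shows "l \<in> \<rat>"
proof -
  have "exp (of_nat n * (2 * pi * \<i> * complex_of_real l)) = 1"
    using assms(2) by (simp add: expo_def exp_of_nat_mult)
  then obtain k :: int where "real n * (2 * pi * l) = of_int (2 * k) * pi"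
    by (auto simp: exp_eq_1)
  then have "l = of_int k / of_int (int n)" using assms(1) by (simp add: field_simps)
  then show ?thesis by simp
qed

text \<open>For nonzero \<open>d\<close> the integral is (e(d) - 1)/(2 pi i d), where e(d) is
  \<open>expo d 1\<close>; for d = 0 the conclusion is immediate.\<close>

lemma expo_integral_zero:
  assumes "(LINT t:{0..<1}|lborel. expo d t) = 0"
  shows "expo d 1 = 1"
proof (cases "d = 0")
  case False
  define c where "c = 2 * pi * \<i> * complex_of_real d"
  have "c \<noteq> 0" using False by (simp add: c_def)
  have "((\<lambda>t. exp (c * complex_of_real t) / c) has_vector_derivative expo d t) (at t within {0..1})" for t
  proof -
    have "((\<lambda>z. exp (c * z) / c) has_field_derivative exp (c * complex_of_real t)) (at (complex_of_real t))"
      using \<open>c \<noteq> 0\<close> by (auto intro!: derivative_eq_intros)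
    then have "((\<lambda>t. exp (c * complex_of_real t) / c) has_vector_derivative exp (c * complex_of_real t)) (at t within {0..1})"
      by (rule has_vector_derivative_real_field)
    then show ?thesis by (simp add: expo_def c_def mult.assoc)
  qed
  then have "(LBINT t. indicator {0..1} t *\<^sub>R expo d t) = exp (c * complex_of_real 1) / c - exp (c * complex_of_real 0) / c"
    by (intro integral_FTC_atLeastAtMost continuous_on_expo) auto
  moreover have "(LINT t:{0..<1}|lborel. expo d t) = (LINT t:{0..1}|lborel. expo d t)"
    by (rule set_integral_discrete_difference[of "{1}"]) auto
  ultimately have "exp c = 1"
    using assms \<open>c \<noteq> 0\<close> by (simp add: set_lebesgue_integral_def)
  then show ?thesis by (simp add: expo_def c_def)
qed simp

section \<open>Inner products of step functions on unions of unit cells\<close>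

definition cells :: "nat set \<Rightarrow> real set" where
  "cells A = (\<Union>a\<in>A. {real a..<real a + 1})"

lemma cells_eq: "{real a + t | a t. a \<in> A \<and> t \<in> {0..<1}} = cells A"
proof -
  have "x \<in> {real a..<real a + 1} \<longleftrightarrow> (\<exists>t\<in>{0..<1}. x = real a + t)" for x a
    by (auto intro!: bexI[of _ "x - real a"])
  then show ?thesis by (fastforce simp: cells_def)
qed

lemma integral_cells:
  fixes g :: "real \<Rightarrow> complex"
  assumes "finite A" and int: "\<And>a. a \<in> A \<Longrightarrow> set_integrable lborel {real a..<real a + 1} g"
  shows "(LINT x:cells A|lborel. g x) = (\<Sum>a\<in>A. LINT t:{0..<1}|lborel. g (real a + t))"
proof -
  have "disjoint_family_on (\<lambda>a. {real a..<real a + 1}) A"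
    by (auto simp: disjoint_family_on_def)
  then have "(LINT x:cells A|lborel. g x) = (\<Sum>a\<in>A. LINT x:{real a..<real a + 1}|lborel. g x)"
    unfolding cells_def using assms by (intro set_integral_finite_Union) auto
  also have "\<dots> = (\<Sum>a\<in>A. LINT t:{0..<1}|lborel. g (real a + t))"
  proof (rule sum.cong[OF refl])
    fix a
    have "(LINT x:{real a..<real a + 1}|lborel. g x) =
        (LBINT t. indicator {real a..<real a + 1} (real a + 1 * t) *\<^sub>R g (real a + 1 * t))"
      unfolding set_lebesgue_integral_def
      using lborel_integral_real_affine[of 1 "\<lambda>x. indicator {real a..<real a + 1} x *\<^sub>R g x" "real a"] by simp
    also have "\<dots> = (LINT t:{0..<1}|lborel. g (real a + t))"
      unfolding set_lebesgue_integral_def by (intro Bochner_Integration.integral_cong) (auto simp: indicator_def)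
    finally show "(LINT x:{real a..<real a + 1}|lborel. g x) = (LINT t:{0..<1}|lborel. g (real a + t))" .
  qed
  finally show ?thesis .
qed

lemma nat_floor_cell: "x \<in> {real a..<real a + 1} \<Longrightarrow> nat \<lfloor>x\<rfloor> = a"
  by (auto simp: nat_eq_iff floor_eq_iff)

text \<open>On the cell at \<open>a\<close> the exponential splits into the a-th power of a quotient
  of nodes and a factor on [0,1) that is the same for all cells. Constant \<open>v\<close> covers
  orthogonality of exponentials, m = 0 covers step functions.\<close>

lemma step_expo_inner:
  assumes "finite A"
  shows "L2_inner (cells A) (\<lambda>x. v (nat \<lfloor>x\<rfloor>) * expo m x) (expo l) =
    (\<Sum>a\<in>A. v a * (expo m 1 / expo l 1) ^ a) * (LINT t:{0..<1}|lborel. expo (m - l) t)"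
proof -
  define g where "g x = v (nat \<lfloor>x\<rfloor>) * expo m x * cnj (expo l x)" for x
  have g: "g x = v a * expo (m - l) x" if "x \<in> {real a..<real a + 1}" for x a
    unfolding g_def nat_floor_cell[OF that] by (simp add: mult.assoc expo_mult_cnj)
  have int: "set_integrable lborel {real a..<real a + 1} g" for a
  proof -
    have "set_integrable lborel {real a..real a + 1} (\<lambda>x. v a * expo (m - l) x)"
      by (intro borel_integrable_atLeastAtMost' continuous_intros continuous_on_expo)
    then have "set_integrable lborel {real a..<real a + 1} (\<lambda>x. v a * expo (m - l) x)"
      by (rule set_integrable_subset) auto
    then show ?thesis
      using g by (subst set_integrable_cong[OF refl refl g]) auto
  qed
  have "L2_inner (cells A) (\<lambda>x. v (nat \<lfloor>x\<rfloor>) * expo m x) (expo l) = (LINT x:cells A|lborel. g x)"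
    by (simp add: L2_inner_def g_def)
  also have "\<dots> = (\<Sum>a\<in>A. LINT t:{0..<1}|lborel. g (real a + t))"
    by (rule integral_cells[OF assms int])
  also have "\<dots> = (\<Sum>a\<in>A. v a * (expo m 1 / expo l 1) ^ a * (LINT t:{0..<1}|lborel. expo (m - l) t))"
  proof (rule sum.cong[OF refl])
    fix a
    have "(LINT t:{0..<1}|lborel. g (real a + t)) =
        (LINT t:{0..<1}|lborel. (v a * (expo m 1 / expo l 1) ^ a) * expo (m - l) t)"
      by (rule set_lebesgue_integral_cong)
         (auto simp: g[of _ a] expo_add_right expo_nat expo_diff_left[of _ _ 1])
    then show "(LINT t:{0..<1}|lborel. g (real a + t)) =
        v a * (expo m 1 / expo l 1) ^ a * (LINT t:{0..<1}|lborel. expo (m - l) t)"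
      by simp
  qed
  finally show ?thesis by (simp add: sum_distrib_right)
qed

lemma step_function_in_L2:
  assumes "finite A"
  shows "in_L2 (cells A) (\<lambda>x. v (nat \<lfloor>x\<rfloor>))"
  unfolding in_L2_def
proof
  show "(\<lambda>x::real. v (nat \<lfloor>x\<rfloor>)) \<in> borel_measurable lborel"
    using measurable_compose[OF measurable_real_floor, of "\<lambda>k. v (nat k)" borel] by simp
  have "set_integrable lborel {real a..<real a + 1} (\<lambda>x. (cmod (v (nat \<lfloor>x\<rfloor>)))\<^sup>2)" for a
  proof -
    have "set_integrable lborel {real a..real a + 1} (\<lambda>x. (cmod (v a))\<^sup>2)"
      by (intro borel_integrable_atLeastAtMost' continuous_intros)
    then have "set_integrable lborel {real a..<real a + 1} (\<lambda>x. (cmod (v a))\<^sup>2)"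
      by (rule set_integrable_subset) auto
    then show ?thesis
      by (subst set_integrable_cong[OF refl refl, where f' = "\<lambda>x. (cmod (v a))\<^sup>2"])
         (simp_all only: nat_floor_cell)
  qed
  then show "set_integrable lborel (cells A) (\<lambda>x. (cmod (v (nat \<lfloor>x\<rfloor>)))\<^sup>2)"
    unfolding cells_def using assms by (intro set_integrable_UN) auto
qed

section \<open>The mask polynomial and the nodes of a spectrum\<close>

definition mask_poly :: "nat set \<Rightarrow> int poly" where
  "mask_poly A = (\<Sum>a\<in>A. monom 1 a)"

lemma coeff_mask_poly: "finite A \<Longrightarrow> coeff (mask_poly A) i = (if i \<in> A then 1 else 0)"
  by (simp add: mask_poly_def coeff_sum)

lemma degree_mask_poly:
  assumes "finite A" "A \<noteq> {}"
  shows "degree (mask_poly A) = Max A"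
proof (rule antisym)
  show "degree (mask_poly A) \<le> Max A"
    using assms by (intro degree_le) (auto simp: coeff_mask_poly)
  show "Max A \<le> degree (mask_poly A)"
    using assms by (intro le_degree) (auto simp: coeff_mask_poly)
qed

text \<open>Being monic makes the roots algebraic integers, as Kronecker's theorem requires.\<close>

lemma lead_coeff_mask_poly: "\<lbrakk>finite A; A \<noteq> {}\<rbrakk> \<Longrightarrow> lead_coeff (mask_poly A) = 1"
  by (simp add: degree_mask_poly coeff_mask_poly)

lemma mask_poly_nonzero: "\<lbrakk>finite A; A \<noteq> {}\<rbrakk> \<Longrightarrow> mask_poly A \<noteq> 0"
  using lead_coeff_mask_poly[of A] by (metis leading_coeff_0_iff zero_neq_one)

lemma poly_mask_poly:
  assumes "finite A"
  shows "poly (complex_poly (mask_poly A)) x = (\<Sum>a\<in>A. x ^ a)"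
proof -
  have "complex_poly (mask_poly A) = (\<Sum>a\<in>A. monom 1 a)"
    using assms by (intro poly_eqI) (simp add: coeff_mask_poly coeff_sum)
  then show ?thesis by (simp add: poly_sum poly_monom)
qed

context
  fixes A :: "nat set" and \<Lambda> :: "real set"
  assumes A: "finite A" "0 \<in> A" and spectrum: "is_spectrum \<Lambda> (cells A)" and "0 \<in> \<Lambda>"
begin

text \<open>Frequencies that differ by an integer share a node, so an infinite spectrum can have
  finitely many nodes.\<close>

definition nodes :: "complex set" where
  "nodes = (\<lambda>l. expo l 1) ` \<Lambda>"

lemma one_in_nodes: "1 \<in> nodes"
  using \<open>0 \<in> \<Lambda>\<close> by (force simp: nodes_def)

lemma norm_nodes: "z \<in> nodes \<Longrightarrow> cmod z = 1"
  by (auto simp: nodes_def)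

text \<open>The inner product of two exponentials is the mask polynomial at z/w times an integral
  over [0,1); the integral vanishes only if the nodes coincide.\<close>

lemma mask_poly_nodes_ratio:
  assumes "z \<in> nodes" "w \<in> nodes" "z \<noteq> w"
  shows "poly (complex_poly (mask_poly A)) (z / w) = 0"
proof -
  obtain l m where lm: "l \<in> \<Lambda>" "m \<in> \<Lambda>" "z = expo l 1" "w = expo m 1"
    using assms by (auto simp: nodes_def)
  then have "L2_inner (cells A) (expo l) (expo m) = 0"
    using spectrum assms by (auto simp: is_spectrum_def)
  then have "(\<Sum>a\<in>A. (z / w) ^ a) = 0 \<or> (LINT t:{0..<1}|lborel. expo (l - m) t) = 0"
    using step_expo_inner[OF A(1), of "\<lambda>_. 1" l m] lm by auto
  moreover have "(LINT t:{0..<1}|lborel. expo (l - m) t) \<noteq> 0"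
  proof
    assume "(LINT t:{0..<1}|lborel. expo (l - m) t) = 0"
    then have "z / w = 1" using expo_integral_zero lm by (simp flip: expo_diff_left)
    then show False using \<open>z \<noteq> w\<close> by auto
  qed
  ultimately show ?thesis by (simp add: poly_mask_poly A)
qed

text \<open>Since 1 is a node, every other node is itself a quotient of distinct nodes and so a
  root.\<close>

lemma finite_nodes: "finite nodes"
proof -
  have "nodes \<subseteq> insert 1 {x. poly (complex_poly (mask_poly A)) x = 0}"
    using mask_poly_nodes_ratio[OF _ one_in_nodes] by auto
  moreover have "mask_poly A \<noteq> 0" using A mask_poly_nonzero by blast
  ultimately show ?thesis
    using poly_roots_finite[of "complex_poly (mask_poly A)"] by (simp add: finite_subset)
qed

text \<open>If the numbers of nodes and of elements of \<open>A\<close> differ, then the projection of the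
  indicator of \<open>[0, 1)\<close> away
  from the vectors \<open>(z ^ b)\<close>, \<open>b \<in> A\<close>, which are orthogonal of squared norm \<open>card A\<close>, contradicts
  completeness.\<close>
lemma card_nodes: "card nodes = card A"
proof -
  define N where "N = complex_of_nat (card A)"
  have "N \<noteq> 0" using A by (auto simp: N_def)
  define v where "v b = (if b = 0 then 1 else 0) - (\<Sum>z\<in>nodes. z ^ b) / N" for b :: nat
  \<comment> \<open>As |w| = 1, the factor 1/w is the conjugate of \<open>w\<close>, and the sum is
    the Hermitian product of \<open>v\<close> with the powers of \<open>w\<close>.\<close>
  have orth: "(\<Sum>b\<in>A. v b * (1 / w) ^ b) = 0" if w: "w \<in> nodes" for w
  proof -
    have "w \<noteq> 0" using norm_nodes[OF w] by auto
    have ratio: "(\<Sum>b\<in>A. (z / w) ^ b) = (if z = w then N else 0)" if "z \<in> nodes" for z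
      using mask_poly_nodes_ratio[OF that w] \<open>w \<noteq> 0\<close> by (auto simp: poly_mask_poly A N_def)
    have "(\<Sum>z\<in>nodes. (z / w) ^ b) = (\<Sum>z\<in>nodes. z ^ b) * (1 / w) ^ b" for b
      by (simp add: sum_divide_distrib power_divide)
    then have "(\<Sum>b\<in>A. v b * (1 / w) ^ b) =
        (\<Sum>b\<in>A. (if b = 0 then 1 else 0) * (1 / w) ^ b) - (\<Sum>b\<in>A. \<Sum>z\<in>nodes. (z / w) ^ b) / N"
      by (simp only: v_def left_diff_distrib sum_subtractf sum_divide_distrib[of _ A] times_divide_eq_left)
    also have "(\<Sum>b\<in>A. (if b = 0 then 1 else 0) * (1 / w) ^ b) = (\<Sum>b\<in>A. if b = 0 then 1 else 0)"
      by (intro sum.cong) auto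
    also have "\<dots> = 1" using A by simp
    also have "(\<Sum>b\<in>A. \<Sum>z\<in>nodes. (z / w) ^ b) = (\<Sum>z\<in>nodes. if z = w then N else 0)"
      by (subst sum.swap) (simp add: ratio)
    also have "\<dots> = N" using w finite_nodes by simp
    finally show ?thesis using \<open>N \<noteq> 0\<close> by simp
  qed
  have "L2_inner (cells A) (\<lambda>x. v (nat \<lfloor>x\<rfloor>)) (expo l) = 0" if "l \<in> \<Lambda>" for l
    using step_expo_inner[OF A(1), of v 0 l] orth[of "expo l 1"] that by (auto simp: nodes_def)
  then have ae: "AE x in lborel. x \<in> cells A \<longrightarrow> v (nat \<lfloor>x\<rfloor>) = 0"
    using spectrum step_function_in_L2[OF A(1), of v] by (auto simp: is_spectrum_def)
  \<comment> \<open>The cell [0,1) has positive measure, so \<open>v\<close> cannot survive there;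
    and v(0) is 1 minus the number of nodes over \<open>N\<close>, because all z^0 are 1.\<close>
  have "v 0 = 0"
  proof (rule ccontr)
    assume "v 0 \<noteq> 0"
    have "AE x in lborel. x \<notin> {0..<1::real}"
      using ae
    proof eventually_elim
      case (elim x)
      show ?case
      proof
        assume x: "x \<in> {0..<1}"
        then have "x \<in> cells A" using A by (force simp: cells_def)
        moreover have "nat \<lfloor>x\<rfloor> = 0" using x nat_floor_cell[of x 0] by simp
        ultimately show False using elim \<open>v 0 \<noteq> 0\<close> by simp
      qed
    qed
    then have "emeasure lborel {0..<1::real} = 0"
      by (subst (asm) AE_iff_null_sets[symmetric]) auto
    then show False by simp
  qed
  then have "of_nat (card nodes) = N" using \<open>N \<noteq> 0\<close> by (simp add: v_def)
  then show ?thesis by (simp add: N_def)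
qed

lemma rational_spectrum:
  assumes "2 * Max A + 2 < 5 * card A"
  shows "\<Lambda> \<subseteq> \<rat>"
proof (rule ccontr)
  assume "\<not> \<Lambda> \<subseteq> \<rat>"
  then obtain l where l: "l \<in> \<Lambda>" "l \<notin> \<rat>" by blast
  define z where "z = expo l 1"
  have z: "z \<in> nodes" using l by (auto simp: z_def nodes_def)
  have nu: "z ^ n \<noteq> 1" if "n > 0" for n
    using rational_of_expo_root_of_unity[OF that] l(2) by (auto simp: z_def)
  have z1: "z \<noteq> 1" using nu[of 1] by auto
  have mask: "lead_coeff (mask_poly A) = 1" "mask_poly A \<noteq> 0"
    using A lead_coeff_mask_poly mask_poly_nonzero by blast+
  have root: "poly (complex_poly (mask_poly A)) w = 0" if "w \<in> nodes" "w \<noteq> 1" for w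
    using mask_poly_nodes_ratio[OF that(1) one_in_nodes that(2)] by simp
  \<comment> \<open>The mask polynomial annihilates every node except 1, which gets x - 1
    instead.\<close>
  have alg: "\<exists>p. p \<noteq> 0 \<and> poly (complex_poly p) w = 0" if w: "w \<in> nodes" for w
  proof (cases "w = 1")
    case True
    have "poly (complex_poly [:-1, 1:]) w = 0" by (simp add: True map_poly_pCons)
    then show ?thesis by (intro exI[of _ "[:-1, 1:]"]) auto
  qed (use root[OF w] mask in blast)
  obtain K \<sigma> where hom: "subfield_hom K \<sigma>" "nodes \<subseteq> K"
      "\<And>n. \<sigma> (of_int n) = of_int n" "\<And>n. of_int n \<in> K"
    and "cmod (\<sigma> z) \<noteq> 1"
    using exists_embedding_off_unit_circle[OF mask(1) root[OF z z1] nu finite_nodes z alg] by blast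
  then have "5 * card nodes \<le> 2 * degree (mask_poly A) + 2"
    using card_le_of_ratios_roots[OF finite_nodes one_in_nodes norm_nodes mask(2)
      mask_poly_nodes_ratio hom z] by blast
  moreover have "degree (mask_poly A) = Max A" using A by (intro degree_mask_poly) auto
  ultimately show False using assms by (simp add: card_nodes)
qed

end

theorem mainTheorem9:
  fixes A :: "nat set" and M :: real and \<Lambda> :: "real set"
  defines "\<Omega> \<equiv> {real a + t | a t. a \<in> A \<and> t \<in> {0..<1}}"
  assumes "finite A" and "0 \<in> A" and "card A \<ge> 2"
    and "\<Omega> \<subseteq> {0..M}" and "M < 5 * real (card A) / 2"
    and "is_spectrum \<Lambda> \<Omega>" and "0 \<in> \<Lambda>"
  shows "\<Lambda> \<subseteq> \<rat>"
proof -
  have \<Omega>: "\<Omega> = cells A" unfolding \<Omega>_def by (rule cells_eq)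
  have "Max A \<in> A" using assms by (auto intro: Max_in)
  have "real (Max A) + 1 \<le> M"
  \<comment> \<open>The last cell is half-open, so its right endpoint is bounded by \<open>M\<close>
    only as a limit of points of \<Omega>.\<close>
  proof (rule dense_le_bounded[of "real (Max A)"])
    fix x assume "real (Max A) < x" "x < real (Max A) + 1"
    then have "x \<in> \<Omega>" using \<open>Max A \<in> A\<close> by (auto simp: \<Omega> cells_def intro!: bexI[of _ "Max A"])
    then show "x \<le> M" using assms(5) by auto
  qed simp
  then have "2 * Max A + 2 < 5 * card A" using assms(6) by linarith
  moreover have "is_spectrum \<Lambda> (cells A)" using assms(7) by (simp add: \<Omega>)
  ultimately show ?thesis using rational_spectrum \<open>finite A\<close> \<open>0 \<in> A\<close> \<open>0 \<in> \<Lambda>\<close> by metis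
qed

end
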